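(* Let $S=\{321,132\}$. Then $f_S(0,x)=1$ and, for $n\ge1$, $$f_S(n,x)=f_S(n-1,x)+\sum_{i=1}^{n-1}x^{\max\{0,n-2i\}}.$$ In particular, $f_S(n,1)=\binom n2+1$. Moreover, for $n\ge0$, $$\begin{aligned}f_S(n+5,x)={}&(x+2)f_S(n+4,x)-2x f_S(n+3,x)-2f_S(n+2,x)\\&+(2x+1)f_S(n+1,x)-x f_S(n,x),\end{aligned}$$ where $f_S(0,x)=1$, $f_S(1,x)=1$, $f_S(2,x)=2$, $f_S(3,x)=x+3$, $f_S(4,x)=x^2+x+5$ and $f_S(5,x)=x^3+x^2+2x+7$.
   Context: $\mathfrak S_n$ is the set of permutations of $\{1,\dots,n\}$. $\operatorname{Av}_n(S)$ is the set of $\pi\in\mathfrak S_n$ having no subsequence order-isomorphic to any element of $S$. $\operatorname{DD}(\pi)$ is the number of indices $k$ with $\pi(k)<k<\pi^{-1}(k)$ (double deficiencies), and $f_S(n,x)=\sum_{\pi\in\operatorname{Av}_n(S)}x^{\operatorname{DD}(\pi)}$. *)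

theory Defs
  imports Complex_Main "HOL-Combinatorics.Permutations"
begin

text \<open>
  A permutation of \<open>{1..n}\<close> is a function \<open>p\<close> with \<open>p permutes {1..n}\<close> (hence the identity
  outside \<open>{1..n}\<close>). Patterns are given in one-line notation as lists, so that 321 is \<open>[3,2,1]\<close>;
  the entry in position \<open>i + 1\<close> of a pattern \<open>s\<close> is \<open>s ! i\<close>.
\<close>

definition contains_pattern :: "nat \<Rightarrow> (nat \<Rightarrow> nat) \<Rightarrow> nat list \<Rightarrow> bool" where
  "contains_pattern n p s \<longleftrightarrow>
     (\<exists>h. strict_mono_on {..<length s} h \<and> h ` {..<length s} \<subseteq> {1..n} \<and>
          (\<forall>i<length s. \<forall>j<length s. p (h i) < p (h j) \<longleftrightarrow> s ! i < s ! j))"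

definition Av :: "nat \<Rightarrow> nat list set \<Rightarrow> (nat \<Rightarrow> nat) set" where
  "Av n S = {p. p permutes {1..n} \<and> (\<forall>s\<in>S. \<not> contains_pattern n p s)}"

definition DD :: "nat \<Rightarrow> (nat \<Rightarrow> nat) \<Rightarrow> nat" where
  "DD n p = card {k \<in> {1..n}. p k < k \<and> k < inv p k}"

text \<open>
  The variable ranges over an arbitrary commutative semiring; the generating polynomial itself is
  the case \<open>x = [:0, 1:]\<close> of type \<open>int poly\<close>.
\<close>

definition dd_poly :: "nat list set \<Rightarrow> nat \<Rightarrow> 'a::comm_semiring_1 \<Rightarrow> 'a" where
  "dd_poly S n x = (\<Sum>p\<in>Av n S. x ^ DD n p)"

end

theory Submission imports Defs begin

text \<open>
  Let \<open>p\<close> avoid 321 and 132. If \<open>p n = n\<close>, then the entry \<open>n\<close> occurs in no copy of either pattern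
  and is no double deficiency, so \<open>p\<close> is just an avoider of length \<open>n - 1\<close>; as permutations are
  the identity outside their interval, it is even the same function. If \<open>n\<close> sits in a position
  \<open>i < n\<close>, avoiding 132 puts every value left of \<open>n\<close> above every value right of it. Each side
  is then increasing, since a descent together with a value of the other side would form 321.
  So \<open>p\<close> is the rotation \<open>(n-i+1) \<dots> n 1 \<dots> (n-i)\<close>, and conversely every such
  rotation is an avoider. Its double deficiencies are the \<open>k\<close> with \<open>i < k \<le> n - i\<close>, which gives the
  summand \<open>x\<close> to the power \<open>max 0 (n - 2 i)\<close>.

  Write \<open>g n\<close> for the sum over \<open>i\<close>. The linear recurrence comes from \<open>g (n+2) = g n + x ^ n + 1\<close> for
  \<open>n \<ge> 1\<close>. With \<open>E\<close> the shift of \<open>n\<close>, the operator \<open>E - 1\<close> turns \<open>f\<close> into \<open>E g\<close>, then \<open>E\<^sup>2 - 1\<close> leaves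
  a combination of \<open>x ^ n\<close> and \<open>1\<close>, which \<open>(E - x) (E - 1)\<close> annihilates; the coefficients of
  the recurrence are those of \<open>(E - x) (E - 1) (E\<^sup>2 - 1) (E - 1)\<close>.
\<close>

section \<open>The two patterns\<close>

lemma contains_pattern_3:
  "contains_pattern n p [u, v, w] \<longleftrightarrow>
     (\<exists>a b c. 1 \<le> a \<and> a < b \<and> b < c \<and> c \<le> n \<and>
        (p a < p b \<longleftrightarrow> u < v) \<and> (p b < p a \<longleftrightarrow> v < u) \<and>
        (p a < p c \<longleftrightarrow> u < w) \<and> (p c < p a \<longleftrightarrow> w < u) \<and>
        (p b < p c \<longleftrightarrow> v < w) \<and> (p c < p b \<longleftrightarrow> w < v))" (is "?L \<longleftrightarrow> ?R")
proof
  assume ?L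
  then obtain h where h: "strict_mono_on {..<3} h" "h ` {..<3} \<subseteq> {1..n}"
    and o: "\<And>i j. i < 3 \<Longrightarrow> j < 3 \<Longrightarrow> p (h i) < p (h j) \<longleftrightarrow> [u, v, w] ! i < [u, v, w] ! j"
    unfolding contains_pattern_def by (auto simp: eval_nat_numeral)
  have "h 0 < h 1" "h 1 < h 2" using h(1) by (auto simp: strict_mono_on_def)
  moreover have "1 \<le> h 0" "h 2 \<le> n"
    using h(2) by (auto simp: image_subset_iff)
  ultimately show ?R
    using o[of 0 1] o[of 1 0] o[of 0 2] o[of 2 0] o[of 1 2] o[of 2 1]
    by (intro exI[of _ "h 0"] exI[of _ "h 1"] exI[of _ "h 2"]) simp
next
  assume ?R
  then obtain a b c where *: "1 \<le> a" "a < b" "b < c" "c \<le> n"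
    "p a < p b \<longleftrightarrow> u < v" "p b < p a \<longleftrightarrow> v < u"
    "p a < p c \<longleftrightarrow> u < w" "p c < p a \<longleftrightarrow> w < u"
    "p b < p c \<longleftrightarrow> v < w" "p c < p b \<longleftrightarrow> w < v" by blast
  let ?h = "(!) [a, b, c]"
  have "strict_mono_on {..<3} ?h"
    using *(2,3) by (auto simp: strict_mono_on_def less_Suc_eq numeral_3_eq_3)
  moreover have "?h ` {..<3} \<subseteq> {1..n}"
    using *(1-4) by (auto simp: less_Suc_eq numeral_3_eq_3)
  moreover have "\<forall>i<3. \<forall>j<3. p (?h i) < p (?h j) \<longleftrightarrow> [u, v, w] ! i < [u, v, w] ! j"
    using *(5-10) by (simp add: All_less_Suc numeral_3_eq_3)
  ultimately show ?L
    unfolding contains_pattern_def by (intro exI[of _ ?h]) (simp add: numeral_3_eq_3)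
qed

lemma Av_iff:
  "p \<in> Av n {[3,2,1],[1,3,2]} \<longleftrightarrow> p permutes {1..n} \<and>
     (\<forall>a b c. 1 \<le> a \<longrightarrow> a < b \<longrightarrow> b < c \<longrightarrow> c \<le> n \<longrightarrow>
        \<not> (p c < p b \<and> p b < p a) \<and> \<not> (p a < p c \<and> p c < p b))"
proof -
  have "contains_pattern n p [3,2,1] \<longleftrightarrow>
      (\<exists>a b c. 1 \<le> a \<and> a < b \<and> b < c \<and> c \<le> n \<and> p c < p b \<and> p b < p a)"
    unfolding contains_pattern_3 by (intro ex_cong1) auto
  moreover have "contains_pattern n p [1,3,2] \<longleftrightarrow>
      (\<exists>a b c. 1 \<le> a \<and> a < b \<and> b < c \<and> c \<le> n \<and> p a < p c \<and> p c < p b)"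
    unfolding contains_pattern_3 by (intro ex_cong1) auto
  ultimately show ?thesis unfolding Av_def by blast
qed

lemma Av_permutes: "p \<in> Av n S \<Longrightarrow> p permutes {1..n}"
  by (simp add: Av_def)

section \<open>Rotations\<close>

text \<open>
  The parameter \<open>i\<close> is the position of the entry \<open>n\<close>; the values are shifted by \<open>n - i\<close> modulo \<open>n\<close>.
\<close>

definition rotation :: "nat \<Rightarrow> nat \<Rightarrow> nat \<Rightarrow> nat" where
  "rotation n i k =
     (if 1 \<le> k \<and> k \<le> i then k + (n - i) else if i < k \<and> k \<le> n then k - i else k)"

lemma rotation_rotation: "i \<le> n \<Longrightarrow> rotation n i (rotation n (n - i) k) = k"
  by (auto simp: rotation_def)

lemma rotation_permutes:
  assumes "i \<le> n"
  shows "rotation n i permutes {1..n}"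
proof (rule inj_imp_permutes)
  show "inj_on (rotation n i) {1..n}"
    using assms rotation_rotation[of "n - i" n] by (intro inj_on_inverseI[of _ "rotation n (n - i)"]) simp
qed (use assms in \<open>auto simp: rotation_def split: if_splits\<close>)

lemma inv_rotation:
  assumes "i \<le> n"
  shows "inv (rotation n i) = rotation n (n - i)"
  by (rule inv_unique_comp)
     (use assms rotation_rotation[of i n] rotation_rotation[of "n - i" n] in \<open>auto simp: fun_eq_iff\<close>)

lemma rotation_in_Av:
  assumes "i \<le> n"
  shows "rotation n i \<in> Av n {[3,2,1],[1,3,2]}"
  unfolding Av_iff using rotation_permutes[OF assms] assms by (auto simp: rotation_def)

text \<open>
  The deficiencies of the rotation are the \<open>k > i\<close>, and those of its inverse, the rotation with
  parameter \<open>n - i\<close>, are the \<open>k > n - i\<close>. For \<open>2 i \<ge> n\<close> there are no double deficiencies, in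
  agreement with truncated subtraction.
\<close>

lemma DD_rotation:
  assumes "1 \<le> i" "i < n"
  shows "DD n (rotation n i) = n - 2 * i"
proof -
  have "{k \<in> {1..n}. rotation n i k < k \<and> k < inv (rotation n i) k} = {i<..n - i}"
    using assms by (auto simp: inv_rotation rotation_def split: if_splits)
  then show ?thesis by (simp add: DD_def)
qed

lemma rotation_inj: "inj_on (rotation n) {1..n - 1}"
proof (rule inj_onI)
  fix i j assume ij: "i \<in> {1..n - 1}" "j \<in> {1..n - 1}" and "rotation n i = rotation n j"
  then have "rotation n i 1 = rotation n j 1" by simp
  with ij have "n - i = n - j" by (simp add: rotation_def)
  with ij show "i = j" by simp linarith
qed

section \<open>Classification of the avoiders\<close>

lemma permutes_eq_card:
  fixes p :: "nat \<Rightarrow> nat"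
  assumes p: "p permutes {1..n}" and k: "k \<in> {1..n}"
  shows "p k = card {y \<in> {1..n}. p y \<le> p k}"
proof -
  have "p ` {y \<in> {1..n}. p y \<le> p k} = {1..p k}"
  proof (rule set_eqI, rule iffI)
    fix z assume z: "z \<in> {1..p k}"
    have "p k \<le> n" using permutes_in_image[OF p, of k] k by simp
    then have "inv p z \<in> {1..n}" using z permutes_in_image[OF permutes_inv[OF p], of z] by simp
    then show "z \<in> p ` {y \<in> {1..n}. p y \<le> p k}"
      using z permutes_inverses(1)[OF p, of z] by (intro image_eqI[of _ _ "inv p z"]) auto
  qed (use permutes_in_image[OF p] in fastforce)
  then show ?thesis
    using card_image[OF inj_on_subset[OF permutes_inj[OF p]], of "{y \<in> {1..n}. p y \<le> p k}"] by simp
qed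

text \<open>The relative order determines a permutation, since \<open>p k\<close> is the rank of \<open>k\<close> in it.\<close>

lemma permutes_eqI_order:
  fixes p q :: "nat \<Rightarrow> nat"
  assumes p: "p permutes {1..n}" and q: "q permutes {1..n}"
    and less: "\<And>a b. \<lbrakk>1 \<le> a; a < b; b \<le> n\<rbrakk> \<Longrightarrow> p a < p b \<longleftrightarrow> q a < q b"
  shows "p = q"
proof
  fix k
  have inj: "p a = p b \<longleftrightarrow> a = b" "q a = q b \<longleftrightarrow> a = b" for a b
    using permutes_inj[OF p] permutes_inj[OF q] by (auto simp: inj_eq)
  have "p y \<le> p k \<longleftrightarrow> q y \<le> q k" if "y \<in> {1..n}" "k \<in> {1..n}" for y
    using that less[of y k] less[of k y] inj[of y k] by (cases y k rule: linorder_cases) auto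
  then have "p k = q k" if "k \<in> {1..n}"
    using that permutes_eq_card[OF p that] permutes_eq_card[OF q that]
    by (metis (mono_tags, lifting) Collect_cong)
  moreover have "p k = q k" if "k \<notin> {1..n}"
    using that p q by (simp add: permutes_not_in)
  ultimately show "p k = q k" by blast
qed

text \<open>
  The positions are split at that of \<open>n\<close>. Comparing any two of them, on the same side or across,
  gives the order of the rotation, and the order determines \<open>p\<close>.
\<close>

lemma Av_not_fixed_eq_rotation:
  assumes av: "p \<in> Av n {[3,2,1],[1,3,2]}" and n: "1 \<le> n" and nf: "p n \<noteq> n"
  obtains i where "1 \<le> i" "i \<le> n - 1" "p = rotation n i"
proof -
  have p: "p permutes {1..n}"
    and no321: "\<And>a b c. \<lbrakk>1 \<le> a; a < b; b < c; c \<le> n; p c < p b; p b < p a\<rbrakk> \<Longrightarrow> False"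
    and no132: "\<And>a b c. \<lbrakk>1 \<le> a; a < b; b < c; c \<le> n; p a < p c; p c < p b\<rbrakk> \<Longrightarrow> False"
    using av unfolding Av_iff by blast+
  define i where "i = inv p n"
  have pi: "p i = n" using permutes_inverses(1)[OF p] by (simp add: i_def)
  have "i \<in> {1..n}" using permutes_in_image[OF permutes_inv[OF p], of n] n by (simp add: i_def)
  then have i: "1 \<le> i" "i \<le> n - 1" using nf pi by (cases "i = n"; force)+
  have neq: "p a \<noteq> p b" if "a \<noteq> b" for a b using that permutes_inj[OF p] by (auto simp: inj_eq)
  have lt_n: "p a < n" if "1 \<le> a" "a \<le> n" "a \<noteq> i" for a
    using that permutes_in_image[OF p, of a] neq[of a i] pi by auto
  have across: "p c < p a" if "1 \<le> a" "a \<le> i" "i < c" "c \<le> n" for a c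
    using no132[of a i c] that neq[of a c] lt_n[of c] pi
    by (cases "a = i") (auto simp: not_less_iff_gr_or_eq intro: ccontr)
  have left: "p a < p b" if "1 \<le> a" "a < b" "b \<le> i" for a b
    using no321[of a b n] that across[of b n] i neq[of a b] by fastforce
  have right: "p a < p b" if "i < a" "a < b" "b \<le> n" for a b
    using no321[of i a b] that i neq[of a b] lt_n[of a] pi by fastforce
  have "p = rotation n i"
  proof (rule permutes_eqI_order[OF p rotation_permutes])
    fix a b assume ab: "1 \<le> a" "a < b" "b \<le> n"
    consider "b \<le> i" | "a \<le> i" "i < b" | "i < a" by linarith
    then show "p a < p b \<longleftrightarrow> rotation n i a < rotation n i b"
    proof cases
      case 1
      then show ?thesis using ab left[of a b] by (auto simp: rotation_def)
    next
      case 2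
      then show ?thesis using ab across[of a b] by (auto simp: rotation_def)
    next
      case 3
      then show ?thesis using ab right[of a b] by (auto simp: rotation_def)
    qed
  qed (use i in simp)
  with i that show thesis by blast
qed

text \<open>
  A largest entry in last position plays no part in a copy of 321 or 132, as neither pattern ends
  with its maximum.
\<close>

lemma Av_fixed_iff:
  "p \<in> Av (Suc n) {[3,2,1],[1,3,2]} \<and> p (Suc n) = Suc n \<longleftrightarrow> p \<in> Av n {[3,2,1],[1,3,2]}"
proof (intro iffI conjI)
  assume av: "p \<in> Av (Suc n) {[3,2,1],[1,3,2]} \<and> p (Suc n) = Suc n"
  then have "p permutes {1..Suc n}" using Av_permutes by blast
  moreover have "{1..Suc n} - {1..n} = {Suc n}" by auto
  ultimately have "p permutes {1..n}"
    using permutes_superset[of p "{1..Suc n}" "{1..n}"] av by simp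
  with av show "p \<in> Av n {[3,2,1],[1,3,2]}" unfolding Av_iff by simp
next
  assume av: "p \<in> Av n {[3,2,1],[1,3,2]}"
  then have p: "p permutes {1..n}" by (rule Av_permutes)
  show last: "p (Suc n) = Suc n" using p by (simp add: permutes_not_in)
  have lt: "p a < Suc n" if "1 \<le> a" "a \<le> n" for a
    using permutes_in_image[OF p, of a] that by simp
  have "p permutes {1..Suc n}" by (rule permutes_subset[OF p]) auto
  moreover have "\<not> (p c < p b \<and> p b < p a) \<and> \<not> (p a < p c \<and> p c < p b)"
    if abc: "1 \<le> a" "a < b" "b < c" "c \<le> Suc n" for a b c
  proof (cases "c = Suc n")
    case True
    then show ?thesis using lt[of b] last abc by simp
  next
    case False
    then have "c \<le> n" using abc by simp
    then show ?thesis using av abc unfolding Av_iff by blast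
  qed
  ultimately show "p \<in> Av (Suc n) {[3,2,1],[1,3,2]}" unfolding Av_iff by blast
qed

lemma Av_Suc:
  "Av (Suc n) {[3,2,1],[1,3,2]} = Av n {[3,2,1],[1,3,2]} \<union> rotation (Suc n) ` {1..n}"
proof (rule set_eqI, rule iffI)
  fix p assume av: "p \<in> Av (Suc n) {[3,2,1],[1,3,2]}"
  show "p \<in> Av n {[3,2,1],[1,3,2]} \<union> rotation (Suc n) ` {1..n}"
  proof (cases "p (Suc n) = Suc n")
    case True
    with av show ?thesis using Av_fixed_iff by blast
  next
    case False
    with av obtain i where "1 \<le> i" "i \<le> n" "p = rotation (Suc n) i"
      using Av_not_fixed_eq_rotation[of p "Suc n"] by (metis diff_Suc_1 le_add1 plus_1_eq_Suc)
    then show ?thesis by simp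
  qed
next
  have "rotation (Suc n) i \<in> Av (Suc n) {[3,2,1],[1,3,2]}" if "i \<in> {1..n}" for i
    by (rule rotation_in_Av) (use that in simp)
  moreover fix p assume "p \<in> Av n {[3,2,1],[1,3,2]} \<union> rotation (Suc n) ` {1..n}"
  ultimately show "p \<in> Av (Suc n) {[3,2,1],[1,3,2]}"
    using Av_fixed_iff by blast
qed

lemma DD_fixed:
  assumes "p permutes {1..n}"
  shows "DD (Suc n) p = DD n p"
proof -
  have "p (Suc n) = Suc n" using assms by (simp add: permutes_not_in)
  then have "{k \<in> {1..Suc n}. p k < k \<and> k < inv p k} = {k \<in> {1..n}. p k < k \<and> k < inv p k}"
    by (auto simp: le_Suc_eq)
  then show ?thesis by (simp add: DD_def)
qed

section \<open>The generating polynomial\<close>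

lemma dd_poly_Suc:
  fixes x :: "'a::comm_semiring_1"
  shows "dd_poly {[3,2,1],[1,3,2]} (Suc n) x =
    dd_poly {[3,2,1],[1,3,2]} n x + (\<Sum>i=1..n. x ^ (Suc n - 2 * i))"
proof -
  let ?A = "Av n {[3,2,1],[1,3,2]}" and ?R = "rotation (Suc n) ` {1..n}"
  have "finite ?A"
    by (rule finite_subset[OF _ finite_permutations[of "{1..n}"]]) (use Av_permutes in blast)+
  moreover have "?A \<inter> ?R = {}"
  proof (rule equals0I)
    fix p assume "p \<in> ?A \<inter> ?R"
    then obtain i where i: "i \<in> {1..n}" "p = rotation (Suc n) i" and "p (Suc n) = Suc n"
      using Av_fixed_iff by blast
    then show False by (auto simp: rotation_def)
  qed
  ultimately have "dd_poly {[3,2,1],[1,3,2]} (Suc n) x =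
      (\<Sum>p\<in>?A. x ^ DD (Suc n) p) + (\<Sum>p\<in>?R. x ^ DD (Suc n) p)"
    unfolding dd_poly_def Av_Suc by (simp add: sum.union_disjoint)
  also have "(\<Sum>p\<in>?A. x ^ DD (Suc n) p) = dd_poly {[3,2,1],[1,3,2]} n x"
    unfolding dd_poly_def by (intro sum.cong refl) (simp only: DD_fixed[OF Av_permutes])
  also have "(\<Sum>p\<in>?R. x ^ DD (Suc n) p) = (\<Sum>i=1..n. x ^ (Suc n - 2 * i))"
    using rotation_inj[of "Suc n"] by (simp add: sum.reindex DD_rotation)
  finally show ?thesis .
qed

lemma dd_poly_0: "dd_poly {[3,2,1],[1,3,2]} 0 x = 1"
proof -
  have "Av 0 {[3,2,1],[1,3,2]} = {id}"
    by (rule set_eqI) (subst Av_iff, auto)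
  then show ?thesis by (simp add: dd_poly_def DD_def)
qed

text \<open>
  This is \<open>g (m+2) = g m + x ^ m + 1\<close> for \<open>m = n + 1\<close>: raising \<open>i\<close> by one and \<open>m\<close> by two preserves the
  exponent, so that only the terms at the two ends are new.
\<close>

lemma rotation_sum_step:
  fixes x :: "'a::comm_semiring_1"
  shows "(\<Sum>i=1..n + 2. x ^ (n + 3 - 2 * i)) = (\<Sum>i=1..n. x ^ (n + 1 - 2 * i)) + x ^ (n + 1) + 1"
proof -
  have "(\<Sum>i=1..n + 2. x ^ (n + 3 - 2 * i)) = x ^ (n + 1) + (\<Sum>i=Suc 1..Suc (n + 1). x ^ (n + 3 - 2 * i))"
    by (subst sum.atLeast_Suc_atMost) auto
  also have "(\<Sum>i=Suc 1..Suc (n + 1). x ^ (n + 3 - 2 * i)) = (\<Sum>i=1..n + 1. x ^ (n + 1 - 2 * i))"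
    by (subst sum.shift_bounds_cl_Suc_ivl) (simp add: numeral_eq_Suc)
  also have "\<dots> = (\<Sum>i=1..n. x ^ (n + 1 - 2 * i)) + 1"
    by simp
  finally show ?thesis by (simp add: ac_simps)
qed

theorem mainTheorem9:
  fixes f :: "nat \<Rightarrow> 'a::comm_ring_1 \<Rightarrow> 'a" and x :: 'a
  defines "f \<equiv> dd_poly {[3,2,1], [1,3,2]}"
  shows "f 0 x = 1 \<and>
    (\<forall>n\<ge>1. f n x = f (n - 1) x + (\<Sum>i=1..n - 1. x ^ nat (max 0 (int n - 2 * int i)))) \<and>
    (\<forall>n. f n 1 = of_nat (n choose 2) + 1) \<and>
    (\<forall>n. f (n + 5) x = (x + 2) * f (n + 4) x - 2 * x * f (n + 3) x - 2 * f (n + 2) x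
            + (2 * x + 1) * f (n + 1) x - x * f n x) \<and>
    f 1 x = 1 \<and>
    f 2 x = 2 \<and>
    f 3 x = x + 3 \<and>
    f 4 x = x^2 + x + 5 \<and>
    f 5 x = x^3 + x^2 + 2 * x + 7"
proof -
  \<comment> \<open>The index is one less than in the introduction, so that the upper bound of the sum is \<open>n\<close>.\<close>
  define g where "g n = (\<Sum>i=1..n. x ^ (n + 1 - 2 * i))" for n
  have f0: "f 0 y = 1" for y unfolding f_def by (rule dd_poly_0)
  have fS: "f (Suc n) y = f n y + (\<Sum>i=1..n. y ^ (Suc n - 2 * i))" for n y
    unfolding f_def by (rule dd_poly_Suc)
  have fg: "f (Suc n) x = f n x + g n" for n by (simp add: fS g_def)
  have g: "g (n + 2) = g n + x ^ (n + 1) + 1" for n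
    using rotation_sum_step[of x n] by (simp add: g_def numeral_3_eq_3)
  have g01: "g 0 = 0" "g (Suc 0) = 1" by (simp_all add: g_def)
  have "f n x = f (n - 1) x + (\<Sum>i=1..n - 1. x ^ nat (max 0 (int n - 2 * int i)))" if "n \<ge> 1" for n
  proof -
    have "nat (max 0 (int n - 2 * int i)) = n - 2 * i" for i by linarith
    then show ?thesis using that fS[of "n - 1" x] by simp
  qed
  moreover have "f n 1 = of_nat (n choose 2) + 1" for n
    by (induction n) (simp_all add: f0 fS numeral_2_eq_2)
  moreover have "f (n + 5) x = (x + 2) * f (n + 4) x - 2 * x * f (n + 3) x - 2 * f (n + 2) x
            + (2 * x + 1) * f (n + 1) x - x * f n x" for n
  proof -
    have fs: "f (n + 1) x = f n x + g n" "f (n + 2) x = f (n + 1) x + g (n + 1)"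
      "f (n + 3) x = f (n + 2) x + g (n + 2)" "f (n + 4) x = f (n + 3) x + g (n + 3)"
      "f (n + 5) x = f (n + 4) x + g (n + 4)"
      using fg[of n] fg[of "n + 1"] fg[of "n + 2"] fg[of "n + 3"] fg[of "n + 4"]
      by (simp_all add: eval_nat_numeral)
    have gs: "g (n + 2) = g n + x ^ (n + 1) + 1" "g (n + 3) = g (n + 1) + x * x ^ (n + 1) + 1"
      "g (n + 4) = g (n + 2) + x * x * x ^ (n + 1) + 1"
      using g[of n] g[of "n + 1"] g[of "n + 2"] by (simp_all add: eval_nat_numeral ac_simps)
    show ?thesis unfolding fs gs by (simp add: algebra_simps)
  qed
  moreover have gv: "g 2 = x + 1" "g 3 = x^2 + 2" "g 4 = x^3 + x + 2"
    using g[of 0] g[of 1] g[of 2] g01 by (simp_all add: eval_nat_numeral algebra_simps)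
  then have "f 1 x = 1" "f 2 x = 2" "f 3 x = x + 3" "f 4 x = x^2 + x + 5"
    "f 5 x = x^3 + x^2 + 2 * x + 7"
    using f0[of x] fg[of 0] fg[of 1] fg[of 2] fg[of 3] fg[of 4] g01
    by (simp_all add: eval_nat_numeral algebra_simps)
  ultimately show ?thesis using f0 by blast
qed

end
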